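(* Let $k$ and $r$ be integers with $\frac{k}{2}\le r\le k-3$, and let $G$ be a graph on $n$ vertices. If $e(G)>\frac{(k-1)n}{2}$, then $G$ contains (as a subgraph, not necessarily induced) a keyring with $r$ leaves and at least $k$ edges.
   Context: All graphs are finite, simple and undirected; $e(G)=|E(G)|$ is the number of edges of $G$. A vertex of a graph is a leaf if it has degree one. A keyring with $r\ge 0$ leaves is a graph obtained from a cycle (of length at least 3) by appending $r$ leaves to one of its vertices, i.e., by adding $r$ new vertices, each joined by a single edge to one and the same fixed vertex of the cycle. *)

theory Defs
  imports Complex_Main
begin

text \<open>A graph is given by its vertex set \<open>V\<close> and its edge set \<open>E\<close>, whose elements are
  two-element subsets of \<open>V\<close>; thus \<open>e(G)\<close> is \<open>card E\<close>.\<close>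

definition simple_graph :: "'a set \<Rightarrow> 'a set set \<Rightarrow> bool" where
  "simple_graph V E \<longleftrightarrow> finite V \<and> (\<forall>e\<in>E. e \<subseteq> V \<and> card e = 2)"

definition subgraph :: "'a set \<Rightarrow> 'a set set \<Rightarrow> 'a set \<Rightarrow> 'a set set \<Rightarrow> bool" where
  "subgraph W F V E \<longleftrightarrow> simple_graph W F \<and> W \<subseteq> V \<and> F \<subseteq> E"

definition cycle_graph :: "'a set \<Rightarrow> 'a set set \<Rightarrow> bool" where
  "cycle_graph C F \<longleftrightarrow>
    (\<exists>vs. distinct vs \<and> length vs \<ge> 3 \<and> C = set vs \<and>
          F = {{vs ! i, vs ! (Suc i mod length vs)} | i. i < length vs})"

definition keyring :: "nat \<Rightarrow> 'a set \<Rightarrow> 'a set set \<Rightarrow> bool" where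
  "keyring r W F \<longleftrightarrow>
    (\<exists>C D v L. cycle_graph C D \<and> v \<in> C \<and> finite L \<and> card L = r \<and> L \<inter> C = {} \<and>
               W = C \<union> L \<and> F = D \<union> {{v, x} | x. x \<in> L})"

end

theory Submission imports Defs begin

text \<open>Put \<open>s = k - r\<close>, so \<open>3 \<le> s \<le> r\<close>. A vertex of degree at least \<open>k - 1\<close> on a cycle with at least
  \<open>s\<close> vertices yields the keyring, because chords at that vertex can be used to shorten the cycle.
  In a counterexample with fewest vertices all degrees are at least \<open>s\<close>. Take a minimal nonempty
  vertex set \<open>S\<close> with at most one outside neighbour (an end block without its cut vertex). By a
  path lemma for 2-connected graphs in the style of Bondy and Jackson, every vertex of \<open>S\<close> lies on
  a cycle of length greater than \<open>s\<close> and so has degree at most \<open>k - 2\<close>. Hence at most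
  \<open>((k - 2)|S| + |S|) / 2\<close> edges meet \<open>S\<close>, and deleting \<open>S\<close> gives a smaller counterexample.\<close>

section \<open>Boundaries, long paths and end blocks\<close>

locale adjacency =
  fixes adj :: "'a \<Rightarrow> 'a \<Rightarrow> bool"
  assumes adj_sym: "adj u w \<Longrightarrow> adj w u"
    and adj_irrefl: "\<not> adj u u"
begin

text \<open>The outer vertex boundary of \<open>Z\<close> in the graph induced on \<open>T\<close>.
  Since \<open>T\<close> is explicit, vertices are deleted by changing \<open>T\<close> while
  \<open>adj\<close> stays fixed.\<close>

definition boundary :: "'a set \<Rightarrow> 'a set \<Rightarrow> 'a set" where
  "boundary T Z = {w \<in> T - Z. \<exists>z\<in>Z. adj z w}"

definition path_in :: "'a set \<Rightarrow> 'a \<Rightarrow> 'a \<Rightarrow> 'a list \<Rightarrow> bool" where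
  "path_in T x y p \<longleftrightarrow> p \<noteq> [] \<and> hd p = x \<and> last p = y \<and> distinct p \<and> set p \<subseteq> T \<and> successively adj p"

lemma path_in_extend:
  assumes p: "path_in U b w p" and u: "u \<in> U" "adj w u"
  shows "\<exists>q. path_in U b u q"
proof (cases "u \<in> set p")
  case True
  then obtain ys zs where "p = ys @ u # zs" by (meson split_list)
  hence "path_in U b u (ys @ [u])"
    using p u(1) by (auto simp: path_in_def successively_append_iff successively_Cons hd_append)
  thus ?thesis ..
next
  case False
  hence "path_in U b u (p @ [u])"
    using p u by (auto simp: path_in_def successively_append_iff)
  thus ?thesis ..
qed

lemma path_in_append:
  assumes "path_in A x b p" "path_in B b y q" "A \<inter> B = {b}"
  shows "path_in (A \<union> B) x y (p @ tl q)"
proof -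
  obtain q' where q: "q = b # q'"
    using assms(2) by (cases q) (auto simp: path_in_def)
  have "set p \<inter> set q' = {}"
  proof -
    have "set p \<inter> set q' \<subseteq> A \<inter> B" "b \<notin> set q'"
      using assms(1,2) q by (auto simp: path_in_def)
    thus ?thesis using assms(3) by auto
  qed
  thus ?thesis
    using assms(1,2) q
    by (auto simp: path_in_def successively_append_iff successively_Cons)
qed

lemma path_in_Cons:
  assumes "path_in A x' y p" "x \<notin> A" "adj x x'"
  shows "path_in (insert x A) x y (x # p)"
  using assms by (auto simp: path_in_def successively_Cons)

lemma path_in_mono: "path_in A x y p \<Longrightarrow> A \<subseteq> B \<Longrightarrow> path_in B x y p"
  by (auto simp: path_in_def)

text \<open>The set of vertices reachable from \<open>b\<close> has empty boundary by
  \<open>path_in_extend\<close>, so it cannot be one of the sets \<open>W\<close> if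
  \<open>y\<close> is missed.\<close>

lemma exists_path_in:
  assumes "b \<in> U" and sep: "\<And>W. W \<subseteq> U \<Longrightarrow> b \<in> W \<Longrightarrow> y \<notin> W \<Longrightarrow> boundary U W \<noteq> {}"
  shows "\<exists>p. path_in U b y p"
proof (rule ccontr)
  assume no: "\<not> ?thesis"
  let ?W = "{w \<in> U. \<exists>p. path_in U b w p}"
  have "path_in U b b [b]" using \<open>b \<in> U\<close> by (auto simp: path_in_def)
  hence "boundary U ?W \<noteq> {}" using no \<open>b \<in> U\<close> by (intro sep) auto
  thus False using path_in_extend unfolding boundary_def by blast
qed

text \<open>The boundary condition says that the graph on \<open>T\<close> becomes 2-connected once the edge \<open>xy\<close> is
  added. The vertex \<open>c\<close> is allowed to have small degree.\<close>

lemma long_path: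
  assumes "finite T" "x \<in> T" "y \<in> T" "x \<noteq> y" "T - {x, y, c} \<noteq> {}"
    and "\<And>Z. Z \<subseteq> T - {x, y} \<Longrightarrow> Z \<noteq> {} \<Longrightarrow> 2 \<le> card (boundary T Z)"
    and "\<And>u. u \<in> T - {x, y, c} \<Longrightarrow> d \<le> card {w \<in> T. adj u w}"
  shows "\<exists>p. path_in T x y p \<and> d < length p"
  using assms
proof (induction "card T" arbitrary: T x y d rule: less_induct)
  case less
  note fin = \<open>finite T\<close> and conn = less.prems(6) and deg = less.prems(7)
  \<comment> \<open>\<open>x\<close> and at most one further vertex cut such a \<open>Z\<close> off.
    A smallest one plays the role of an end block of the graph on \<open>T - {x}\<close> without its
    cut vertex, chosen away from \<open>y\<close>. Subsets of \<open>{c}\<close> are excluded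
    because the degree of \<open>c\<close> is not controlled.\<close>
  define Q where "Q Z \<longleftrightarrow> Z \<subseteq> T - {x, y} \<and> Z - {c} \<noteq> {} \<and> card (boundary (T - {x}) Z) \<le> 1" for Z
  have "boundary (T - {x}) (T - {x, y}) \<subseteq> {y}" by (auto simp: boundary_def)
  hence "card (boundary (T - {x}) (T - {x, y})) \<le> 1"
    using card_mono[of "{y}"] by fastforce
  hence "Q (T - {x, y})" using less.prems(5) by (auto simp: Q_def)
  then obtain Z where "Q Z" and Zmin: "\<And>Z'. Q Z' \<Longrightarrow> card Z \<le> card Z'"
    using ex_has_least_nat[of Q "T - {x, y}" card] by blast
  hence ZT: "Z \<subseteq> T - {x, y}" and Zc: "Z - {c} \<noteq> {}" and Z1: "card (boundary (T - {x}) Z) \<le> 1"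
    by (auto simp: Q_def)
  have finZ: "finite Z" using ZT fin finite_subset by blast
  have sub2: "2 \<le> card (boundary (T - {x}) Z')" if "Z' \<subset> Z" "Z' \<noteq> {}" "Z' \<noteq> {c}" for Z'
  proof -
    have "card Z' < card Z" using that finZ psubset_card_mono by blast
    hence "\<not> Q Z'" using Zmin by force
    thus ?thesis using that ZT by (auto simp: Q_def)
  qed
  have fb: "finite (boundary A B)" if "finite A" for A B using that by (auto simp: boundary_def)
  have Z2: "2 \<le> card (boundary T Z)" using conn ZT Zc by blast
  have bsub: "boundary T Z \<subseteq> insert x (boundary (T - {x}) Z)" by (auto simp: boundary_def)
  \<comment> \<open>\<open>Z\<close> has two boundary vertices in \<open>T\<close> but at most one
    after \<open>x\<close> is removed. So the boundary consists of \<open>x\<close> and one cut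
    vertex \<open>b\<close>.\<close>
  have xb: "x \<in> boundary T Z"
  proof (rule ccontr)
    assume "x \<notin> boundary T Z"
    hence "boundary T Z \<subseteq> boundary (T - {x}) Z" using bsub by blast
    thus False using Z2 Z1 card_mono[of "boundary (T - {x}) Z" "boundary T Z"] fb fin by fastforce
  qed
  have "card (boundary T Z) \<le> card (insert x (boundary (T - {x}) Z))"
    using bsub fb fin by (intro card_mono) auto
  also have "\<dots> \<le> Suc (card (boundary (T - {x}) Z))"
    using fb fin by (simp add: card_insert_if)
  finally have "card (boundary (T - {x}) Z) = 1" using Z1 Z2 by linarith
  then obtain b where b: "boundary (T - {x}) Z = {b}" by (auto simp: card_1_singleton_iff)
  hence bT: "b \<in> T" "b \<noteq> x" "b \<notin> Z" by (auto simp: boundary_def)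
  have nbr: "w \<in> insert x (insert b Z)" if "z \<in> Z" "w \<in> T" "adj z w" for z w
    using that b by (auto simp: boundary_def)
  have inner: "boundary (T - {x}) Z' \<subseteq> boundary (insert b Z) Z'" if "Z' \<subseteq> Z" for Z'
  proof
    fix w assume "w \<in> boundary (T - {x}) Z'"
    then obtain z where "w \<in> T" "w \<noteq> x" "w \<notin> Z'" "z \<in> Z'" "adj z w" by (auto simp: boundary_def)
    thus "w \<in> boundary (insert b Z) Z'" using that nbr[of z w] by (auto simp: boundary_def)
  qed
  have c2: "2 \<le> card (boundary (T - {x}) {c})" if "c \<in> Z" "\<not> adj x c"
  proof -
    have "boundary T {c} \<subseteq> boundary (T - {x}) {c}"
      using that(2) adj_sym[of c x] by (auto simp: boundary_def)
    moreover have "2 \<le> card (boundary T {c})" using conn[of "{c}"] that(1) ZT by auto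
    ultimately show ?thesis
      using card_mono[of "boundary (T - {x}) {c}" "boundary T {c}"] fb fin by simp
  qed
  \<comment> \<open>The path enters \<open>Z\<close> at \<open>x'\<close>, and \<open>c\<close> is
    preferred as entry point. Then either \<open>x' = c\<close>, so \<open>{c}\<close> is not among
    the sets to be checked in the induction, or \<open>c\<close> is not adjacent to \<open>x\<close>
    and \<open>c2\<close> applies.\<close>
  obtain x' where x': "x' \<in> Z" "adj x x'" "c \<in> Z \<Longrightarrow> adj x c \<Longrightarrow> x' = c"
  proof -
    obtain z where "z \<in> Z" "adj z x" using xb by (auto simp: boundary_def)
    thus ?thesis using that[of z] that[of c] adj_sym[of z x] by metis
  qed
  \<comment> \<open>Length \<open>d\<close> is enough here, as \<open>x\<close> will be
    prepended.\<close>
  have "\<exists>p. path_in (insert b Z) x' b p \<and> d \<le> length p"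
  proof (cases "Z - {x', c} = {}")
    case False
    have "\<exists>p. path_in (insert b Z) x' b p \<and> d - 1 < length p"
    \<comment> \<open>Induction on the piece \<open>insert b Z\<close> with ends \<open>x'\<close>
      and \<open>b\<close>: an inner vertex loses at most the neighbour \<open>x\<close>, hence the
      bound \<open>d - 1\<close>.\<close>
    proof (rule less.hyps)
      show "card (insert b Z) < card T"
        using ZT bT less.prems(2) fin by (intro psubset_card_mono) auto
      show "2 \<le> card (boundary (insert b Z) Z')" if "Z' \<subseteq> insert b Z - {x', b}" "Z' \<noteq> {}" for Z'
      proof -
        have Z': "Z' \<subset> Z" using that x' by auto
        have "2 \<le> card (boundary (T - {x}) Z')"
        proof (cases "Z' = {c}")
          case True
          thus ?thesis using c2 x'(3) that Z' by blast
        qed (use sub2 Z' that in blast)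
        also have "\<dots> \<le> card (boundary (insert b Z) Z')"
          using inner Z' fb finZ by (intro card_mono) auto
        finally show ?thesis .
      qed
      show "d - 1 \<le> card {w \<in> insert b Z. adj u w}" if "u \<in> insert b Z - {x', b, c}" for u
      proof -
        have "u \<in> T - {x, y, c}" using that ZT by auto
        hence "d \<le> card {w \<in> T. adj u w}" by (rule deg)
        also have "\<dots> \<le> card (insert x {w \<in> insert b Z. adj u w})"
          using nbr[of u] that finZ by (intro card_mono) auto
        also have "\<dots> \<le> Suc (card {w \<in> insert b Z. adj u w})"
          by (simp add: card_insert_if finZ)
        finally show ?thesis by simp
      qed
      show "insert b Z - {x', b, c} \<noteq> {}" using False bT by auto
    qed (use finZ x' bT in auto)
    then obtain p where "path_in (insert b Z) x' b p" "d - 1 < length p" by blast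
    thus ?thesis by (intro exI[of _ p]) auto
  next
    \<comment> \<open>Now \<open>Z\<close> is \<open>{x'}\<close> or \<open>{x', c}\<close>. The
      degree of \<open>x'\<close> gives \<open>d\<close> at most \<open>card Z + 1\<close>, which is
      the number of vertices of a path through all of \<open>Z\<close> to \<open>b\<close>.\<close>
    case True
    hence x'c: "x' \<noteq> c" using Zc x' by auto
    have "d \<le> card {w \<in> T. adj x' w}" using x' x'c ZT by (intro deg) auto
    also have "{w \<in> T. adj x' w} \<subseteq> insert x (insert b (Z - {x'}))"
      using nbr[OF x'(1)] adj_irrefl by auto
    hence "card {w \<in> T. adj x' w} \<le> card (insert x (insert b (Z - {x'})))"
      using finZ by (intro card_mono) auto
    also have "\<dots> \<le> Suc (card Z)"
    proof -
      have "0 < card Z" using x'(1) finZ by (auto simp: card_gt_0_iff)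
      thus ?thesis using x'(1) finZ by (auto simp: card_insert_if)
    qed
    finally have d: "d \<le> Suc (card Z)" .
    show ?thesis
    proof (cases "c \<in> Z")
      case False
      hence Z: "Z = {x'}" using True x' by auto
      have "adj x' b" using b Z by (auto simp: boundary_def)
      hence "path_in (insert b Z) x' b [x', b]" using Z bT by (auto simp: path_in_def)
      thus ?thesis using d Z by (intro exI[of _ "[x', b]"]) auto
    next
      case cZ: True
      hence Z: "Z = {x', c}" using True x' by auto
      have le2: "2 \<le> card (boundary (T - {x}) {c})" using c2 x' x'c cZ by auto
      have sub: "boundary (T - {x}) {c} \<subseteq> {x', b}"
        using nbr[OF cZ] Z by (auto simp: boundary_def)
      have "x' \<noteq> b" using x'(1) bT(3) by blast
      hence "boundary (T - {x}) {c} = {x', b}"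
        using le2 sub by (intro card_seteq) auto
      hence "adj c x'" "adj c b" by (auto simp: boundary_def)
      hence "path_in (insert b Z) x' b [x', c, b]"
        using Z bT x'c adj_sym[OF \<open>adj c x'\<close>] by (auto simp: path_in_def)
      thus ?thesis using d Z x'c by (intro exI[of _ "[x', c, b]"]) auto
    qed
  qed
  then obtain p where p: "path_in (insert b Z) x' b p" "d \<le> length p" by blast
  \<comment> \<open>The path continues from \<open>b\<close> to \<open>y\<close> outside
    \<open>Z\<close> and \<open>x\<close>. If a set \<open>W\<close> blocked this, then
    \<open>W \<union> Z\<close> would have no boundary vertex but \<open>x\<close>, against the
    assumption on boundaries.\<close>
  have "\<exists>q. path_in (T - Z - {x}) b y q"
  proof (rule exists_path_in)
    show "b \<in> T - Z - {x}" using bT by auto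
    fix W assume W: "W \<subseteq> T - Z - {x}" "b \<in> W" "y \<notin> W"
    show "boundary (T - Z - {x}) W \<noteq> {}"
    proof
      assume "boundary (T - Z - {x}) W = {}"
      hence "boundary T (W \<union> Z) \<subseteq> {x}"
        using nbr W unfolding boundary_def by blast
      hence "card (boundary T (W \<union> Z)) \<le> 1" using card_mono[of "{x}"] by fastforce
      moreover have "2 \<le> card (boundary T (W \<union> Z))" using W ZT by (intro conn) auto
      ultimately show False by simp
    qed
  qed
  then obtain q where q: "path_in (T - Z - {x}) b y q" by blast
  have "path_in (insert b Z \<union> (T - Z - {x})) x' y (p @ tl q)"
    using bT by (intro path_in_append[OF p(1) q]) auto
  moreover have "insert b Z \<union> (T - Z - {x}) = T - {x}" using ZT bT by auto
  ultimately have "path_in (insert x (T - {x})) x y (x # p @ tl q)"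
    using x' by (intro path_in_Cons) auto
  hence "path_in T x y (x # p @ tl q)" using less.prems(2) by (simp add: insert_absorb)
  thus ?case using p(2) by (intro exI[of _ "x # p @ tl q"]) auto
qed

text \<open>A path from \<open>v\<close> to its neighbour \<open>y\<close> closes to a cycle. It
  comes from \<open>long_path\<close> on \<open>S\<close> together with its boundary; the possible
  boundary vertex is the exceptional \<open>c\<close>, since its neighbours may lie outside.\<close>

lemma minimal_small_boundary_on_long_cycles:
  assumes "finite V" "V \<noteq> {}" "3 \<le> d" and deg: "\<And>v. v \<in> V \<Longrightarrow> d \<le> card {w \<in> V. adj v w}"
  shows "\<exists>S \<subseteq> V. S \<noteq> {} \<and> card (boundary V S) \<le> 1 \<and>
    (\<forall>v\<in>S. \<exists>y p. path_in V v y p \<and> d < length p \<and> adj v y)"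
proof -
  define Q where "Q S \<longleftrightarrow> S \<subseteq> V \<and> S \<noteq> {} \<and> card (boundary V S) \<le> 1" for S
  have "Q V" using assms(2) by (auto simp: Q_def boundary_def)
  then obtain S where "Q S" and Smin: "\<And>S'. Q S' \<Longrightarrow> card S \<le> card S'"
    using ex_has_least_nat[of Q V card] by blast
  hence S: "S \<subseteq> V" "S \<noteq> {}" "card (boundary V S) \<le> 1" by (auto simp: Q_def)
  have finS: "finite S" using S(1) assms(1) finite_subset by blast
  have finb: "finite (boundary V A)" for A using assms(1) by (auto simp: boundary_def)
  have sub2: "2 \<le> card (boundary V S')" if "S' \<subset> S" "S' \<noteq> {}" for S'
  proof -
    have "card S' < card S" using that finS psubset_card_mono by blast
    hence "\<not> Q S'" using Smin by force
    thus ?thesis using that S by (auto simp: Q_def)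
  qed
  obtain c where c: "boundary V S \<subseteq> {c}"
    using S(3) finb[of S] by (metis One_nat_def card_le_Suc0_iff_eq subsetI singleton_iff)
  define T where "T = S \<union> boundary V S"
  have TV: "T \<subseteq> V" using S(1) by (auto simp: T_def boundary_def)
  have finT: "finite T" using finS finb by (auto simp: T_def)
  have nbr: "w \<in> T" if "z \<in> S" "w \<in> V" "adj z w" for z w
    using that by (auto simp: T_def boundary_def)
  have "\<exists>y p. path_in V v y p \<and> d < length p \<and> adj v y" if v: "v \<in> S" for v
  proof -
    let ?N = "{w \<in> V. adj v w}"
    have "3 \<le> card ?N" using deg v S(1) assms(3) by (meson le_trans subsetD)
    have "?N \<noteq> {}" using \<open>3 \<le> card ?N\<close> by force
    then obtain y where y: "y \<in> V" "adj v y" by auto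
    \<comment> \<open>Degree at least 3 provides a neighbour besides \<open>y\<close> and
      \<open>c\<close>, so \<open>long_path\<close> has a vertex to work with.\<close>
    have "\<not> ?N \<subseteq> {y, c}"
    proof
      assume "?N \<subseteq> {y, c}"
      hence "card ?N \<le> card {y, c}" by (intro card_mono) auto
      also have "\<dots> \<le> 2" by (simp add: card_insert_if)
      finally show False using \<open>3 \<le> card ?N\<close> by simp
    qed
    then obtain u where u: "u \<in> V" "adj v u" "u \<noteq> y" "u \<noteq> c" by auto
    have "\<exists>p. path_in T v y p \<and> d < length p"
    proof (rule long_path[where c = c])
      show "T - {v, y, c} \<noteq> {}" using u nbr[OF v] adj_irrefl by blast
      show "d \<le> card {w \<in> T. adj u w}" if "u \<in> T - {v, y, c}" for u
      proof -
        have "u \<in> S" using that c by (auto simp: T_def)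
        hence "{w \<in> T. adj u w} = {w \<in> V. adj u w}" using nbr TV by auto
        thus ?thesis using deg \<open>u \<in> S\<close> S(1) by auto
      qed
      show "2 \<le> card (boundary T Z)" if Z: "Z \<subseteq> T - {v, y}" "Z \<noteq> {}" for Z
      proof (cases "Z \<subseteq> S")
        case True
        hence "boundary T Z = boundary V Z" using nbr TV by (auto simp: boundary_def)
        thus ?thesis using True Z v sub2[of Z] by auto
      next
        \<comment> \<open>\<open>Z\<close> contains the cut vertex \<open>c'\<close>, so minimality
          is applied to the other side: the part \<open>R\<close> not in \<open>Z\<close> or its
          boundary lies in \<open>S\<close>, and its boundary is within that of
          \<open>Z\<close>.\<close>
        case False
        then obtain c' where c': "c' \<in> Z" "c' \<in> boundary V S" using Z(1) by (auto simp: T_def)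
        define R where "R = T - Z - boundary T Z"
        have RS: "R \<subseteq> S" using c' c by (auto simp: R_def T_def)
        show ?thesis
        proof (rule ccontr)
          assume "\<not> ?thesis"
          hence le1: "card (boundary T Z) \<le> 1" by simp
          have "boundary V R \<subseteq> boundary T Z"
          proof
            fix w assume "w \<in> boundary V R"
            then obtain z where z: "w \<in> V" "w \<notin> R" "z \<in> R" "adj z w" by (auto simp: boundary_def)
            hence "w \<in> T" using nbr RS by blast
            moreover have "w \<notin> Z"
              using z adj_sym unfolding R_def boundary_def by blast
            ultimately show "w \<in> boundary T Z" using z by (auto simp: R_def)
          qed
          hence "card (boundary V R) \<le> 1"
            using le1 card_mono[of "boundary T Z" "boundary V R"] finT by (fastforce simp: boundary_def)
          moreover have "R \<noteq> {}"
          proof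
            assume "R = {}"
            hence "{v, y} \<subseteq> boundary T Z" using Z v y nbr[OF v] by (auto simp: R_def T_def)
            hence "card {v, y} \<le> card (boundary T Z)" using finT by (intro card_mono) (auto simp: boundary_def)
            moreover have "v \<noteq> y" using y adj_irrefl by blast
            ultimately show False using le1 by simp
          qed
          ultimately have "R = S" using sub2[of R] RS by (cases "R = S") auto
          \<comment> \<open>By minimality \<open>R\<close> is all of \<open>S\<close>, yet
            \<open>c'\<close> in \<open>Z\<close> has a neighbour in \<open>S\<close>, which
            \<open>R\<close> omits.\<close>
          obtain z where z: "z \<in> S" "adj z c'" using c'(2) by (auto simp: boundary_def)
          hence "z \<in> Z \<union> boundary T Z"
            using c'(1) adj_sym[OF z(2)] by (auto simp: boundary_def T_def)
          thus False using z(1) \<open>R = S\<close> by (auto simp: R_def)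
        qed
      qed
    qed (use finT v y nbr[OF v] adj_irrefl T_def in auto)
    thus ?thesis using path_in_mono TV y by blast
  qed
  thus ?thesis using S by blast
qed

end

section \<open>Counting the edges that meet a vertex set\<close>

lemma adjacency_edges:
  assumes "simple_graph V E"
  shows "adjacency (\<lambda>u w. {u, w} \<in> E)"
proof
  show "{w, u} \<in> E" if "{u, w} \<in> E" for u w using that by (simp add: insert_commute)
  show "{u, u} \<notin> E" for u using assms by (force simp: simple_graph_def)
qed

lemma card_incident_edges:
  assumes "simple_graph V E" "v \<in> V"
  shows "card {e \<in> E. v \<in> e} = card {w \<in> V. {v, w} \<in> E}"
proof -
  have "{e \<in> E. v \<in> e} = (\<lambda>w. {v, w}) ` {w \<in> V. {v, w} \<in> E}"
  proof (intro equalityI subsetI)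
    fix e assume e: "e \<in> {e \<in> E. v \<in> e}"
    hence "card e = 2" "e \<subseteq> V" using assms by (auto simp: simple_graph_def)
    then obtain a b where "e = {a, b}" by (auto simp: card_2_iff)
    thus "e \<in> (\<lambda>w. {v, w}) ` {w \<in> V. {v, w} \<in> E}"
      using e \<open>e \<subseteq> V\<close> by (auto simp: insert_commute)
  qed auto
  moreover have "inj_on (\<lambda>w. {v, w}) {w \<in> V. {v, w} \<in> E}"
    by (auto simp: inj_on_def doubleton_eq_iff)
  ultimately show ?thesis by (simp add: card_image)
qed

text \<open>The degree sum counts edges inside \<open>S\<close> twice and edges leaving
  \<open>S\<close> once. The latter all end in the same outside vertex, so there are at most
  \<open>card S\<close> of them and adding \<open>card S\<close> makes up the deficit.\<close>

lemma card_edges_meeting: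
  assumes G: "simple_graph V E" and S: "S \<subseteq> V"
    and bd: "card (adjacency.boundary (\<lambda>u w. {u, w} \<in> E) V S) \<le> 1"
  shows "2 * card {e \<in> E. e \<inter> S \<noteq> {}} \<le> (\<Sum>v\<in>S. card {w \<in> V. {v, w} \<in> E}) + card S"
proof -
  interpret adjacency "\<lambda>u w. {u, w} \<in> E" by (rule adjacency_edges[OF G])
  let ?E = "{e \<in> E. e \<inter> S \<noteq> {}}"
  have fin: "finite V" "finite S" "finite E" "finite ?E"
    using G S finite_subset[of E "Pow V"] by (auto simp: simple_graph_def intro: finite_subset)
  have "finite (boundary V S)" using fin by (auto simp: boundary_def)
  then obtain c where c: "boundary V S \<subseteq> {c}"
    using bd by (metis One_nat_def card_le_Suc0_iff_eq subsetI singleton_iff)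
  let ?X = "{e \<in> ?E. \<not> e \<subseteq> S}"
  have "?X \<subseteq> (\<lambda>v. {v, c}) ` S"
  proof
    fix e assume e: "e \<in> ?X"
    hence "card e = 2" "e \<subseteq> V" using G by (auto simp: simple_graph_def)
    moreover obtain v w where vw: "v \<in> e" "v \<in> S" "w \<in> e" "w \<notin> S" using e by auto
    ultimately have "e = {v, w}" by (auto simp: card_2_iff)
    hence "w \<in> boundary V S" using e vw \<open>e \<subseteq> V\<close> by (auto simp: boundary_def)
    thus "e \<in> (\<lambda>v. {v, c}) ` S" using c vw \<open>e = {v, w}\<close> by auto
  qed
  hence X: "card ?X \<le> card S"
    using fin by (meson card_image_le card_mono finite_imageI le_trans)
  have "2 \<le> card {v \<in> S. v \<in> e} + (if \<not> e \<subseteq> S then 1 else 0)" if "e \<in> ?E" for e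
  proof (cases "e \<subseteq> S")
    case True
    hence "{v \<in> S. v \<in> e} = e" by auto
    thus ?thesis using that G by (auto simp: simple_graph_def)
  next
    case False
    have "card {v \<in> S. v \<in> e} > 0" using that fin by (auto simp: card_gt_0_iff)
    thus ?thesis using False by simp
  qed
  hence "(\<Sum>e\<in>?E. 2) \<le> (\<Sum>e\<in>?E. card {v \<in> S. v \<in> e} + (if \<not> e \<subseteq> S then 1 else 0))"
    by (intro sum_mono) auto
  also have "\<dots> = (\<Sum>e\<in>?E. card {v \<in> S. v \<in> e}) + card ?X"
    using fin by (simp add: sum.distrib sum.inter_filter[symmetric])
  also have "(\<Sum>e\<in>?E. card {v \<in> S. v \<in> e}) = (\<Sum>v\<in>S. card {e \<in> ?E. v \<in> e})"
    using fin sum.swap_restrict[of ?E S "\<lambda>_ _. 1::nat" "\<lambda>e v. v \<in> e"] by simp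
  also have "\<dots> = (\<Sum>v\<in>S. card {w \<in> V. {v, w} \<in> E})"
  proof (rule sum.cong)
    fix v assume "v \<in> S"
    hence "{e \<in> ?E. v \<in> e} = {e \<in> E. v \<in> e}" by auto
    thus "card {e \<in> ?E. v \<in> e} = card {w \<in> V. {v, w} \<in> E}"
      using card_incident_edges[OF G] \<open>v \<in> S\<close> S by auto
  qed simp
  finally show ?thesis using X by simp
qed

section \<open>Keyrings from long cycles\<close>

lemma card_cycle_edges:
  assumes "distinct vs" "length vs \<ge> 3"
  shows "card {{vs ! i, vs ! (Suc i mod length vs)} | i. i < length vs} = length vs"
proof -
  let ?n = "length vs"
  let ?f = "\<lambda>i. {vs ! i, vs ! (Suc i mod ?n)}"
  have "inj_on ?f {..<?n}"
  proof (rule inj_onI)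
    fix i j assume ij: "i \<in> {..<?n}" "j \<in> {..<?n}" "?f i = ?f j"
    have lt: "Suc i mod ?n < ?n" "Suc j mod ?n < ?n"
      using assms(2) by (auto intro: mod_less_divisor)
    \<comment> \<open>Equal edges at different indices would make each index the cyclic successor of
      the other, which is impossible on three or more vertices.\<close>
    have "i = j \<or> (i = Suc j mod ?n \<and> Suc i mod ?n = j)"
      using ij lt assms(1) by (auto simp: doubleton_eq_iff nth_eq_iff_index_eq)
    thus "i = j" using ij assms(2) by (auto simp: mod_Suc split: if_splits)
  qed
  hence "card (?f ` {..<?n}) = ?n" by (simp add: card_image)
  moreover have "?f ` {..<?n} = {?f i | i. i < ?n}" by auto
  ultimately show ?thesis by simp
qed

text \<open>The leaves are any \<open>r\<close> neighbours of \<open>v\<close> off the cycle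
  \<open>v # q\<close>.\<close>

lemma keyring_if_cycle:
  assumes G: "simple_graph V E"
    and q: "distinct (v # q)" "set (v # q) \<subseteq> V" "successively (\<lambda>u w. {u, w} \<in> E) (v # q)"
      "{v, last q} \<in> E" "2 \<le> length q"
    and r: "r \<le> card ({w \<in> V. {v, w} \<in> E} - set q)"
  shows "\<exists>W F. subgraph W F V E \<and> keyring r W F \<and> card F = r + Suc (length q)"
proof -
  interpret adjacency "\<lambda>u w. {u, w} \<in> E" by (rule adjacency_edges[OF G])
  let ?vs = "v # q"
  let ?n = "length ?vs"
  define D where "D = {{?vs ! i, ?vs ! (Suc i mod ?n)} | i. i < ?n}"
  obtain L where L: "L \<subseteq> {w \<in> V. {v, w} \<in> E} - set q" "card L = r" "finite L"
    using obtain_subset_with_card_n[OF r] by metis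
  have vL: "v \<notin> L" using L adj_irrefl by auto
  let ?W = "set ?vs \<union> L" and ?F = "D \<union> {{v, x} | x. x \<in> L}"
  have DE: "e \<in> E \<and> e \<subseteq> set ?vs" if e: "e \<in> D" for e
  proof -
    obtain i where i: "i < ?n" "e = {?vs ! i, ?vs ! (Suc i mod ?n)}"
      using e unfolding D_def by blast
    have "e \<in> E"
    proof (cases "Suc i < ?n")
      case True
      hence "{?vs ! i, ?vs ! Suc i} \<in> E" using q(3) successively_nth by blast
      thus ?thesis using i True by simp
    next
      case False
      hence "Suc i = ?n" using i by simp
      hence "?vs ! i = last q" "?vs ! (Suc i mod ?n) = v"
        using q(5) by (auto simp: last_conv_nth nth_Cons')
      thus ?thesis using q(4) i by (simp add: insert_commute)
    qed
    moreover have "Suc i mod ?n < ?n" by (intro mod_less_divisor) simp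
    ultimately show ?thesis using i nth_mem by blast
  qed
  have fin: "finite D" unfolding D_def by simp
  have FE: "?F \<subseteq> E" using DE L by auto
  have "subgraph ?W ?F V E"
    unfolding subgraph_def simple_graph_def
  proof (intro conjI ballI)
    show "e \<subseteq> ?W" if "e \<in> ?F" for e using that DE by auto
    show "card e = 2" if "e \<in> ?F" for e using that FE G by (auto simp: simple_graph_def)
    show "?W \<subseteq> V" using q(2) L(1) by auto
  qed (use L FE in auto)
  moreover have "cycle_graph (set ?vs) D"
    unfolding cycle_graph_def using q by (intro exI[of _ ?vs]) (auto simp: D_def)
  hence "keyring r ?W ?F"
    unfolding keyring_def using L vL by (intro exI[of _ "set ?vs"] exI[of _ D] exI[of _ v] exI[of _ L]) auto
  moreover have "card ?F = r + Suc (length q)"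
  proof -
    have "card ((\<lambda>x. {v, x}) ` L) = r"
      using L(2) by (subst card_image) (auto simp: inj_on_def doubleton_eq_iff)
    moreover have "(\<lambda>x. {v, x}) ` L = {{v, x} | x. x \<in> L}" by auto
    moreover have "D \<inter> {{v, x} | x. x \<in> L} = {}" using DE vL L(1) by fastforce
    moreover have "card D = ?n"
      unfolding D_def using q by (intro card_cycle_edges) auto
    ultimately show ?thesis using fin L(3) by (simp add: card_Un_disjoint)
  qed
  ultimately show ?thesis by blast
qed

text \<open>If \<open>v\<close> has too many neighbours on the cycle, then the chords at \<open>v\<close> shorten it to a cycle with
  exactly \<open>s - 1\<close> of them.\<close>

lemma keyring_if_long_cycle:
  assumes G: "simple_graph V E"
    and q: "distinct (v # q)" "set (v # q) \<subseteq> V" "successively (\<lambda>u w. {u, w} \<in> E) (v # q)"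
      "{v, last q} \<in> E"
    and s: "3 \<le> s" "s \<le> length q" and deg: "r + s \<le> Suc (card {w \<in> V. {v, w} \<in> E})"
  shows "\<exists>W F. subgraph W F V E \<and> keyring r W F \<and> r + s \<le> card F"
proof -
  let ?N = "{w \<in> V. {v, w} \<in> E}"
  \<comment> \<open>A prefix of \<open>q\<close> of length \<open>j\<close> closes to a cycle with
    at least \<open>s\<close> edges. At most \<open>s - 1\<close> of the at least
    \<open>r + s - 1\<close> neighbours of \<open>v\<close> lie on it, so \<open>r\<close> remain as
    leaves.\<close>
  have "\<exists>j. j \<le> length q \<and> s - 1 \<le> j \<and> card (?N \<inter> set (take j q)) \<le> s - 1 \<and> {v, last (take j q)} \<in> E"
  proof (cases "card (?N \<inter> set q) \<le> s - 1")
    case True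
    thus ?thesis using s q by (intro exI[of _ "length q"]) auto
  next
    case False
    \<comment> \<open>The shortest prefix with \<open>s - 1\<close> neighbours of \<open>v\<close>
      ends in such a neighbour, so a chord (or the closing edge) completes the cycle.\<close>
    define P where "P j \<longleftrightarrow> s - 1 \<le> card (?N \<inter> set (take j q))" for j
    define j where "j = (LEAST j. P j)"
    have PL: "P (length q)" using False by (simp add: P_def)
    have Pj: "P j" unfolding j_def by (rule LeastI[of P, OF PL])
    have jl: "j \<le> length q" unfolding j_def by (rule Least_le[of P, OF PL])
    have "j \<noteq> 0" using Pj s by (auto simp: P_def intro!: Nat.gr0I)
    then obtain i where i: "j = Suc i" by (cases j) auto
    have nP: "\<not> P i" using not_less_Least[of i P] i j_def by simp
    have tk: "take j q = take i q @ [q ! i]" using i jl by (simp add: take_Suc_conv_app_nth)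
    have qi: "q ! i \<in> ?N"
    proof (rule ccontr)
      assume "q ! i \<notin> ?N"
      hence "?N \<inter> set (take j q) = ?N \<inter> set (take i q)" using tk by auto
      thus False using Pj nP by (simp add: P_def)
    qed
    hence "?N \<inter> set (take j q) = insert (q ! i) (?N \<inter> set (take i q))" using tk by auto
    hence "card (?N \<inter> set (take j q)) \<le> Suc (card (?N \<inter> set (take i q)))"
      by (simp add: card_insert_if)
    hence "card (?N \<inter> set (take j q)) \<le> s - 1" using nP by (simp add: P_def)
    moreover have "s - 1 \<le> j"
    proof -
      have "card (?N \<inter> set (take j q)) \<le> card (set (take j q))" by (intro card_mono) auto
      also have "\<dots> \<le> j" using card_length[of "take j q"] by simp
      finally show ?thesis using Pj by (simp add: P_def)
    qed
    ultimately show ?thesis using jl tk qi by (intro exI[of _ j]) auto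
  qed
  then obtain j where j: "j \<le> length q" "s - 1 \<le> j" "card (?N \<inter> set (take j q)) \<le> s - 1"
    "{v, last (take j q)} \<in> E" by blast
  let ?q = "take j q"
  have "finite ?N" using G by (simp add: simple_graph_def)
  have "card ?N = card (?N - set ?q) + card (?N \<inter> set ?q)"
    using \<open>finite ?N\<close> by (subst card_Un_disjoint[symmetric]) (auto intro: arg_cong[of _ _ card])
  hence "r \<le> card (?N - set ?q)" using deg j(3) s by linarith
  moreover have "successively (\<lambda>u w. {u, w} \<in> E) (v # ?q)"
    using q(3) by (metis append_take_drop_id append_Cons successively_append_iff)
  ultimately have "\<exists>W F. subgraph W F V E \<and> keyring r W F \<and> card F = r + Suc (length ?q)"
    using q j s set_take_subset[of j q] by (intro keyring_if_cycle[OF G]) (auto dest: in_set_takeD)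
  thus ?thesis using j s by fastforce
qed

section \<open>The edge bound by induction on the number of vertices\<close>

lemma card_edges_le_if_no_keyring:
  assumes "simple_graph V E" "3 \<le> s" "s \<le> r"
    and "\<nexists>W F. subgraph W F V E \<and> keyring r W F \<and> r + s \<le> card F"
  shows "2 * card E \<le> (r + s - 1) * card V"
  using assms
proof (induction "card V" arbitrary: V E rule: less_induct)
  case less
  note G = less.prems(1)
  have finV: "finite V" using G by (simp add: simple_graph_def)
  have finE: "finite E" using G finite_subset[of E "Pow V"] by (auto simp: simple_graph_def)
  show ?case
  proof (cases "V = {}")
    case True
    hence "E = {}" using G by (fastforce simp: simple_graph_def)
    thus ?thesis by simp
  next
    case False
    interpret adjacency "\<lambda>u w. {u, w} \<in> E" by (rule adjacency_edges[OF G])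
    \<comment> \<open>A nonempty set meeting at most its proportional share of edges can be deleted,
      and the bound for the rest is the induction hypothesis.\<close>
    have "\<exists>S\<subseteq>V. S \<noteq> {} \<and> 2 * card {e \<in> E. e \<inter> S \<noteq> {}} \<le> (r + s - 1) * card S"
    proof (cases "\<exists>v\<in>V. card {w \<in> V. {v, w} \<in> E} < s")
      case True
      then obtain v where v: "v \<in> V" "card {w \<in> V. {v, w} \<in> E} < s" by auto
      have "{e \<in> E. e \<inter> {v} \<noteq> {}} = {e \<in> E. v \<in> e}" by auto
      \<comment> \<open>Here \<open>s \<le> r\<close> enters: twice a degree of at most
        \<open>s - 1\<close> is at most \<open>r + s - 1\<close>.\<close>
      hence "2 * card {e \<in> E. e \<inter> {v} \<noteq> {}} \<le> r + s - 1"
        using card_incident_edges[OF G v(1)] v(2) less.prems by simp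
      thus ?thesis using v(1) by (intro exI[of _ "{v}"]) auto
    next
      case False
      then obtain S where S: "S \<subseteq> V" "S \<noteq> {}" "card (boundary V S) \<le> 1"
        and cyc: "\<And>v. v \<in> S \<Longrightarrow> \<exists>y p. path_in V v y p \<and> s < length p \<and> {v, y} \<in> E"
        using minimal_small_boundary_on_long_cycles[OF finV \<open>V \<noteq> {}\<close> less.prems(2)]
        by (metis (no_types, lifting) not_less)
      have small: "card {w \<in> V. {v, w} \<in> E} \<le> r + s - 2" if v: "v \<in> S" for v
      proof (rule ccontr)
        assume "\<not> ?thesis"
        hence big: "r + s \<le> Suc (card {w \<in> V. {v, w} \<in> E})" by simp
        obtain y p where p: "path_in V v y p" "s < length p" "{v, y} \<in> E" using cyc[OF v] by blast
        then obtain q where q: "p = v # q" by (cases p) (auto simp: path_in_def)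
        have "q \<noteq> []" using p(2) q less.prems(2) by auto
        hence "\<exists>W F. subgraph W F V E \<and> keyring r W F \<and> r + s \<le> card F"
          using p q less.prems(2) big
          by (intro keyring_if_long_cycle[OF G, of v q]) (auto simp: path_in_def)
        thus False using less.prems(4) by blast
      qed
      have "2 * card {e \<in> E. e \<inter> S \<noteq> {}} \<le> (\<Sum>v\<in>S. card {w \<in> V. {v, w} \<in> E}) + card S"
        by (rule card_edges_meeting[OF G S(1,3)])
      also have "(\<Sum>v\<in>S. card {w \<in> V. {v, w} \<in> E}) \<le> card S * (r + s - 2)"
        using sum_bounded_above[of S "\<lambda>v. card {w \<in> V. {v, w} \<in> E}" "r + s - 2"] small by simp
      also have "card S * (r + s - 2) + card S = (r + s - 1) * card S"
      proof -
        have "r + s - 1 = Suc (r + s - 2)" using less.prems(2) by simp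
        thus ?thesis by (simp add: algebra_simps)
      qed
      finally show ?thesis using S by (intro exI[of _ S]) auto
    qed
    then obtain S where S: "S \<subseteq> V" "S \<noteq> {}"
      "2 * card {e \<in> E. e \<inter> S \<noteq> {}} \<le> (r + s - 1) * card S" by blast
    let ?E = "{e \<in> E. e \<inter> S = {}}"
    have "2 * card ?E \<le> (r + s - 1) * card (V - S)"
    proof (rule less.hyps)
      show "card (V - S) < card V" using S finV by (intro psubset_card_mono) auto
      show "simple_graph (V - S) ?E" using G by (auto simp: simple_graph_def)
      show "\<nexists>W F. subgraph W F (V - S) ?E \<and> keyring r W F \<and> r + s \<le> card F"
        using less.prems(4) unfolding subgraph_def by blast
    qed (use less.prems in auto)
    moreover have "card E = card ?E + card {e \<in> E. e \<inter> S \<noteq> {}}"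
      using finE by (subst card_Un_disjoint[symmetric]) (auto intro: arg_cong[of _ _ card])
    moreover have "card V = card (V - S) + card S"
      using S(1) finV by (simp add: card_Diff_subset card_mono finite_subset)
    ultimately show ?thesis using S(3) by (simp add: algebra_simps)
  qed
qed

theorem theorem3:
  fixes k r :: int and n :: nat and V :: "'a set" and E :: "'a set set"
  assumes "real_of_int k / 2 \<le> real_of_int r" and "r \<le> k - 3"
    and "simple_graph V E" and "card V = n"
    and "real (card E) > (real_of_int k - 1) * real n / 2"
  shows "\<exists>W F. subgraph W F V E \<and> keyring (nat r) W F \<and> int (card F) \<ge> k"
proof (rule ccontr)
  assume no: "\<not> ?thesis"
  \<comment> \<open>In these terms the hypotheses become \<open>3 \<le> s\<close> and
    \<open>s \<le> r\<close>; in particular \<open>r\<close> is positive and \<open>nat r\<close>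
    loses nothing.\<close>
  define s where "s = nat (k - r)"
  have kr: "k \<le> 2 * r" using assms(1) by linarith
  have k: "k = int (nat r + s)" and s: "3 \<le> s" "s \<le> nat r"
    using kr assms(2) by (auto simp: s_def)
  have "2 * card E \<le> (nat r + s - 1) * card V"
  proof (rule card_edges_le_if_no_keyring[OF assms(3) s])
    show "\<nexists>W F. subgraph W F V E \<and> keyring (nat r) W F \<and> nat r + s \<le> card F"
      using no unfolding k of_nat_le_iff nat_int by simp
  qed
  hence "real (2 * card E) \<le> real ((nat r + s - 1) * card V)" by (simp only: of_nat_le_iff)
  also have "\<dots> = (real_of_int k - 1) * real n"
    using kr k s assms(4) by (auto simp: of_nat_diff)
  finally show False using assms(5) by simp
qed

end
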